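(* Suppose $f$ does not vanish in $\mathbb{Z}_n^2$. Consider the perturbed raster scan $\mathbf{t}_{kl}=\tau(k,l)+(\delta^1_k,\delta^2_l)$, $k,l=0,\dots,q-1$, and suppose that, for some real numbers $\theta_{kl}$, $\nu^{kl}\odot g^{kl}=e^{\mathrm{i}\theta_{kl}}\mu^{kl}\odot f^{kl}$ on $\mathcal{M}^{kl}$ for all $k,l$. Put $a^i_j=2\delta^i_{j+1}-\delta^i_j-\delta^i_{j+2}$ for $i=1,2$. Let $\{\delta^i_{j}\}_{j\in J}$ be the subset of perturbations satisfying, i.e. let $J$ be the set of indices $j\in\{0,\dots,q-1\}$ satisfying, $$\tau\ \ge\ \max_{i=1,2}\{|a^i_{j}|+\delta^i_{j+1}-\delta^i_{j}\},$$ $$2\tau\ \le\ m-\max_{i=1,2}\{\delta^i_{j+2}-\delta^i_{j}\},$$ $$m-\tau\ \ge\ 1+\max_{k'}\max_{i=1,2}\{|a^i_{j}|+\delta^i_{k'+1}-\delta^i_{k'}\}.$$ Suppose $$\gcd_{j\in J}\left(|a^i_{j}|\right)=1,\qquad i=1,2.$$ Let $\{c^i_j\}_{i=1,2;\,0\le j\le q-1}$ be any integers with $\sum_{j=0}^{q-1}c^1_ja^1_j=\sum_{j=0}^{q-1}c^2_ja^2_j=1$ whose only nonzero entries are those with $j\in J$, and let $\mathbf{r}=(r_1,r_2)\in\mathbb{R}^2$ be given by $$r_1=\sum_{k=0}^{q-1}c^1_k\Delta^1_k,\quad r_2=\sum_{l=0}^{q-1}c^2_l\Delta^2_l,\qquad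 \Delta^1_k=2\theta_{k+1,l}-\theta_{k+2,l}-\theta_{kl},\quad \Delta^2_l=2\theta_{k,l+1}-\theta_{k,l+2}-\theta_{kl}$$ (these quantities depend, modulo $2\pi$, only on the one index shown). Then both the object and probe errors have a constant scaling factor and an affine phase profile: $$g(\mathbf{n})/f(\mathbf{n})=\alpha^{-1}(0)\exp(\mathrm{i}\,\mathbf{n}\cdot\mathbf{r}),\quad \mathbf{n}\in\mathbb{Z}_n^2,$$ $$\nu^{00}(\mathbf{n})/\mu^{00}(\mathbf{n})=\alpha(0)\exp\big(\mathrm{i}\phi(0)-\mathrm{i}\,\mathbf{n}\cdot\mathbf{r}\big),\quad \mathbf{n}\in\mathcal{M}^{00}.$$ Further, the block phases have an affine profile: $$\theta_{kl}=\theta_{00}+\mathbf{t}_{kl}\cdot\mathbf{r}\mod 2\pi,\qquad k,l=0,\dots,q-1.$$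
   Context: Let $m<n$ be positive integers and $n=q\tau$ with $\tau,q\in\mathbb{N}$. The object domain is $\mathbb{Z}_n^2=\{0,\dots,n-1\}^2$ with periodic boundary condition, i.e. additions of pixel positions and shifts are modulo $n$ in each coordinate. The object is $f:\mathbb{Z}_n^2\to\mathbb{C}$. The initial probe area is $\mathcal{M}^{00}=\{0,\dots,m-1\}^2$; the probe $\mu^{00}$ has support $\mathcal{M}^{00}$ (nonzero at every pixel of $\mathcal{M}^{00}$, zero outside). A probe estimate is a function $\nu^{00}$ on $\mathcal{M}^{00}$, nonvanishing there (zero outside), and an object estimate is a function $g:\mathbb{Z}_n^2\to\mathbb{C}$. The perturbations $\delta^1_k,\delta^2_l$ ($k,l=0,\dots,q-1$) are integers with $\delta^1_0=\delta^2_0=0$, so $\mathbf{t}_{00}=(0,0)$. Indices of $\delta^i$, $a^i$, $\theta$ are taken modulo $q$ (periodic boundary condition). Set $\mathcal{M}^{kl}=\mathcal{M}^{00}+\mathbf{t}_{kl}$, $\mu^{kl}(\mathbf{n})=\mu^{00}(\mathbf{n}-\mathbf{t}_{kl})$, $\nu^{kl}(\mathbf{n})=\nu^{00}(\mathbf{n}-\mathbf{t}_{kl})$; $f^{kl},g^{kl}$ are the restrictions of $f,g$ to $\mathcal{M}^{kl}$; $\odot$ is the entrywise product. The functions $\alpha>0$ and $\phi\in\mathbb{R}$ on $\mathcal{M}^{00}$ are defined by $\nu^{00}(\mathbf{n})/\mu^{00}(\mathbf{n})=\alpha(\mathbf{n})\exp(\mathrm{i}\phi(\mathbf{n}))$,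 and $\alpha(0),\phi(0)$ are their values at $\mathbf{n}=(0,0)$.
   Formalization: The formula for g/f carries the extra constant factor exp(i(θ_00−φ(0))), which the printed formula omits; and it is assumed in addition that 2τ+δ^i_{j+2}−δ^i_j ≥ −m for all j in J, i=1,2. Without these the claim is false. *)

theory Defs
  imports Complex_Main "HOL-Library.Product_Plus" "HOL-Library.Real_Mod"
begin

text \<open>
  Pixels are pairs of integers. The object domain is the set of canonical representatives
  modulo \<open>n\<close>; shifted pixel positions are always brought back to it by \<open>wrap n\<close>.
  Functions on the domain are total functions on pixels that are only evaluated on representatives.
\<close>

type_synonym pixel = "int \<times> int"

definition torus :: "nat \<Rightarrow> pixel set" where
  "torus n = {0..<int n} \<times> {0..<int n}"

definition wrap :: "nat \<Rightarrow> pixel \<Rightarrow> pixel" where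
  "wrap n p = (fst p mod int n, snd p mod int n)"

definition init_area :: "nat \<Rightarrow> pixel set" where
  "init_area m = {0..<int m} \<times> {0..<int m}"

definition shifted_area :: "nat \<Rightarrow> nat \<Rightarrow> pixel \<Rightarrow> pixel set" where
  "shifted_area n m t = (\<lambda>p. wrap n (p + t)) ` init_area m"

definition shifted_probe :: "nat \<Rightarrow> pixel \<Rightarrow> (pixel \<Rightarrow> complex) \<Rightarrow> pixel \<Rightarrow> complex" where
  "shifted_probe n t \<mu> p = \<mu> (wrap n (p - t))"

definition is_probe :: "nat \<Rightarrow> nat \<Rightarrow> (pixel \<Rightarrow> complex) \<Rightarrow> bool" where
  "is_probe n m \<mu> \<longleftrightarrow> (\<forall>p\<in>torus n. \<mu> p \<noteq> 0 \<longleftrightarrow> p \<in> init_area m)"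

definition dotp :: "pixel \<Rightarrow> real \<times> real \<Rightarrow> real" where
  "dotp p r = real_of_int (fst p) * fst r + real_of_int (snd p) * snd r"

text \<open>
  \<open>\<delta> i j\<close> is the perturbation $\delta^i_j$ with $i \in \{1,2\}$ and $0 \le j < q$. All block indices
  are taken modulo \<open>q\<close>, so only the values at indices below \<open>q\<close> matter.
\<close>

definition scan_pos :: "nat \<Rightarrow> (nat \<Rightarrow> nat \<Rightarrow> int) \<Rightarrow> nat \<Rightarrow> nat \<Rightarrow> pixel" where
  "scan_pos \<tau> \<delta> k l = (int \<tau> * int k + \<delta> 1 k, int \<tau> * int l + \<delta> 2 l)"

definition second_diff :: "nat \<Rightarrow> (nat \<Rightarrow> nat \<Rightarrow> int) \<Rightarrow> nat \<Rightarrow> nat \<Rightarrow> int" where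
  "second_diff q \<delta> i j = 2 * \<delta> i ((j + 1) mod q) - \<delta> i j - \<delta> i ((j + 2) mod q)"

definition good_indices :: "nat \<Rightarrow> nat \<Rightarrow> nat \<Rightarrow> (nat \<Rightarrow> nat \<Rightarrow> int) \<Rightarrow> nat set" where
  "good_indices m q \<tau> \<delta> = {j. j < q \<and>
     int \<tau> \<ge> (MAX i\<in>{1,2}. \<bar>second_diff q \<delta> i j\<bar> + \<delta> i ((j + 1) mod q) - \<delta> i j) \<and>
     2 * int \<tau> \<le> int m - (MAX i\<in>{1,2}. \<delta> i ((j + 2) mod q) - \<delta> i j) \<and>
     int m - int \<tau> \<ge> 1 + (MAX k\<in>{..<q}. MAX i\<in>{1,2}.
        \<bar>second_diff q \<delta> i j\<bar> + \<delta> i ((k + 1) mod q) - \<delta> i k)}"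

definition phase_diff1 :: "nat \<Rightarrow> (nat \<Rightarrow> nat \<Rightarrow> real) \<Rightarrow> nat \<Rightarrow> nat \<Rightarrow> real" where
  "phase_diff1 q \<theta> k l = 2 * \<theta> ((k + 1) mod q) l - \<theta> ((k + 2) mod q) l - \<theta> k l"

definition phase_diff2 :: "nat \<Rightarrow> (nat \<Rightarrow> nat \<Rightarrow> real) \<Rightarrow> nat \<Rightarrow> nat \<Rightarrow> real" where
  "phase_diff2 q \<theta> k l = 2 * \<theta> k ((l + 1) mod q) - \<theta> k ((l + 2) mod q) - \<theta> k l"

text \<open>
  For perturbations of arbitrary size the block two steps ahead of \<open>j\<close> may lie far behind block
  \<open>j\<close>. The second condition in \<^const>\<open>good_indices\<close> is only the upper bound
  $t_{j+2} - t_j \le m$ on the displacement (componentwise, with $t_{j+2} - t_j$ read as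
  $2\tau + \delta_{j+2} - \delta_j$ across the period). The following is the matching lower bound
  $t_{j+2} - t_j \ge -m$; it holds whenever the perturbations do not reverse the order of the
  scan, and without it the phase ambiguity need not be affine: for $m = 10$, $n = 36$, $q = 9$,
  $\tau = 4$ and scan positions $0, 7, 15, 7, 0, 7, 15, 22, 29$ in both coordinates the index
  set is $\{2\}$ with $a_2 = -1$, but the pixels $3, \dots, 6$ of a block are linked to no other pixel.
\<close>

definition bounded_backtracking ::
    "nat \<Rightarrow> nat \<Rightarrow> nat \<Rightarrow> (nat \<Rightarrow> nat \<Rightarrow> int) \<Rightarrow> nat set \<Rightarrow> bool" where
  "bounded_backtracking m q \<tau> \<delta> J \<longleftrightarrow>
     (\<forall>j\<in>J. \<forall>i\<in>{1,2}. 2 * int \<tau> + \<delta> i ((j + 2) mod q) - \<delta> i j \<ge> - int m)"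

end

theory Submission
  imports Defs
begin

text \<open>
  On each block the object ratio \<open>g / f\<close> times the shifted probe ratio \<open>\<nu> / \<mu>\<close> is the
  constant \<open>exp (\<i> \<theta>)\<close>, so moving from one block to an overlapping one relates values of
  the probe ratio at two pixels.
  Comparing blocks \<open>j\<close>, \<open>j + 1\<close>, \<open>j + 2\<close> in one direction, two
  consecutive shifts differ by \<open>a\<^sub>j\<close>, so the probe ratio is multiplied by a fixed phase
  under translation by \<open>a\<^sub>j\<close>. Consecutive blocks overlap in more than \<open>\<bar>a\<^sub>j\<bar>\<close> pixels,
  hence the object ratio inherits this translation law on the whole torus. A Bezout combination
  turns it into a law for translation by one pixel, which forces an affine phase.
\<close>

section \<open>Covering and translation laws on the integers\<close>

text \<open>A discrete intermediate value argument: \<open>t\<close> may run backwards in between,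
  but at some consecutive pair it must pass from at most \<open>z\<close> to above
  \<open>z\<close>.\<close>

lemma cover_by_steps:
  fixes t :: "nat \<Rightarrow> int"
  assumes "t 0 \<le> z" "z < t q" and step: "\<And>k. k < q \<Longrightarrow> t (Suc k) - t k \<le> b"
  shows "\<exists>k<q. t k \<le> z \<and> z < t k + b"
proof -
  have "\<exists>k<q. t k \<le> z \<and> z < t (Suc k)"
    using assms(1,2)
  proof (induction q)
    case (Suc q)
    then show ?case by (cases "z < t q") (auto intro: less_SucI)
  qed auto
  then obtain k where "k < q" "t k \<le> z" "z < t (Suc k)" by blast
  with step[of k] show ?thesis by (intro exI[of _ k]) auto
qed

text \<open>The induction runs in both directions because Bezout coefficients may be
  negative.\<close>

lemma translation_multiple:
  fixes H :: "int \<Rightarrow> complex"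
  assumes shift: "\<And>z. H (z + a) = H z * cis w"
  shows "H (z + k * a) = H z * cis (of_int k * w)"
proof (induction k rule: int_induct[where k = 0])
  case (step1 i)
  then show ?case
    using shift[of "z + i * a"] by (simp add: algebra_simps cis_mult)
next
  case (step2 i)
  have "H (z + (i - 1) * a) = H (z + (i - 1) * a) * cis w * cis (- w)"
    by (simp add: mult.assoc cis_mult)
  also have "\<dots> = H z * cis (of_int i * w) * cis (- w)"
    using shift[of "z + (i - 1) * a"] step2 by (simp add: algebra_simps)
  finally show ?case by (simp add: mult.assoc cis_mult algebra_simps)
qed simp

lemma translation_combination:
  fixes H :: "int \<Rightarrow> complex"
  assumes "finite J" and shift: "\<And>j z. j \<in> J \<Longrightarrow> H (z + a j) = H z * cis (w j)"
  shows "H (z + (\<Sum>j\<in>J. c j * a j)) = H z * cis (\<Sum>j\<in>J. of_int (c j) * w j)"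
  using assms
proof (induction J arbitrary: z rule: finite_induct)
  case (insert i J)
  have "H (z + (\<Sum>j\<in>J. c j * a j) + c i * a i) =
      H (z + (\<Sum>j\<in>J. c j * a j)) * cis (of_int (c i) * w i)"
    by (rule translation_multiple) (use insert in auto)
  then show ?case using insert by (simp add: algebra_simps cis_mult)
qed simp

lemma periodic_mod:
  fixes H :: "int \<Rightarrow> complex"
  assumes "\<And>x. H (x + n) = H x"
  shows "H (x mod n) = H x"
  using translation_multiple[of H n 0 "x mod n" "x div n"] assms by simp

section \<open>From the block relations to translation laws\<close>

text \<open>\<open>H\<close> and \<open>L\<close> are the object and probe ratios along a line. The
  shift by \<open>a\<close> splits into a move between blocks 0 and 1 and a move between blocks 1
  and 2, in either order. The two possible intermediate pixels add up to \<open>v + (v + a)\<close>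
  and are at most \<open>m\<close> apart, so they cannot both leave the probe area.\<close>

lemma probe_ratio_shift:
  fixes H L :: "int \<Rightarrow> complex" and t0 t1 t2 m :: int
  assumes block0: "\<And>x. x \<in> {0..<m} \<Longrightarrow> H (x + t0) * L x = cis \<theta>0"
    and block1: "\<And>x. x \<in> {0..<m} \<Longrightarrow> H (x + t1) * L x = cis \<theta>1"
    and block2: "\<And>x. x \<in> {0..<m} \<Longrightarrow> H (x + t2) * L x = cis \<theta>2"
    and dist: "\<bar>t2 - t0\<bar> \<le> m"
    and a: "a = 2 * t1 - t0 - t2"
    and v: "v \<in> {0..<m}" "v + a \<in> {0..<m}"
  shows "L v = L (v + a) * cis (2 * \<theta>1 - \<theta>2 - \<theta>0)"
proof -
  \<comment> \<open>The local pixels \<open>x\<close> and \<open>y\<close> lie over the same object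
    pixel \<open>x + t = y + s\<close>, so \<open>H\<close> cancels.\<close>
  have link: "L y = L x * cis (\<eta> - \<zeta>)"
    if "\<And>x. x \<in> {0..<m} \<Longrightarrow> H (x + s) * L x = cis \<eta>"
      "\<And>x. x \<in> {0..<m} \<Longrightarrow> H (x + t) * L x = cis \<zeta>"
      "x \<in> {0..<m}" "y \<in> {0..<m}" "y = x + t - s" for s t x y \<eta> \<zeta>
  proof -
    have "H (x + t) * L x = cis \<zeta>" "H (x + t) * L y = cis \<eta>"
      using that(2)[OF that(3)] that(1)[OF that(4)] that(5) by simp_all
    then have "L y * cis \<zeta> = L x * cis \<eta>"
      by (metis mult.assoc mult.commute)
    then have "L y * (cis \<zeta> * cis (- \<zeta>)) = L x * (cis \<eta> * cis (- \<zeta>))"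
      by (metis mult.assoc)
    then show ?thesis by (simp add: cis_mult)
  qed
  \<comment> \<open>The two routes from \<open>v + a\<close> to \<open>v\<close>; because \<open>\<bar>t2 - t0\<bar> \<le> m\<close>,
    at least one of them stays inside the probe area.\<close>
  have "v + a + t2 - t1 \<in> {0..<m} \<or> v + a + t0 - t1 \<in> {0..<m}"
    using v dist a by auto
  then show ?thesis
  proof
    assume u: "v + a + t2 - t1 \<in> {0..<m}" (is "?u \<in> _")
    have "L v = L ?u * cis (\<theta>1 - \<theta>0)"
      by (rule link[OF block1 block0 u v(1)]) (simp_all add: a)
    moreover have "L ?u = L (v + a) * cis (\<theta>1 - \<theta>2)"
      by (rule link[OF block1 block2 v(2) u]) simp_all
    ultimately show ?thesis by (simp add: mult.assoc cis_mult algebra_simps)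
  next
    assume u: "v + a + t0 - t1 \<in> {0..<m}" (is "?u \<in> _")
    have "L v = L ?u * cis (\<theta>1 - \<theta>2)"
      by (rule link[OF block1 block2 u v(1)]) (simp_all add: a)
    moreover have "L ?u = L (v + a) * cis (\<theta>1 - \<theta>0)"
      by (rule link[OF block1 block0 v(2) u]) simp_all
    ultimately show ?thesis by (simp add: mult.assoc cis_mult algebra_simps)
  qed
qed

text \<open>Modulo \<open>n\<close>, some block contains both \<open>z\<close> and
  \<open>z + a\<close>. The product of the two ratios is constant on it, so the law for
  \<open>L\<close> carries over to \<open>H\<close>.\<close>

lemma object_ratio_shift:
  fixes H L :: "int \<Rightarrow> complex" and t :: "nat \<Rightarrow> int"
  assumes block: "\<And>k x. k < q \<Longrightarrow> x \<in> {0..<m} \<Longrightarrow> H (x + t k) * L x = cis (\<theta> k)"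
    and period: "\<And>x. H (x + n) = H x"
    and "0 < n" "t 0 = 0" "t q = n"
    and overlap: "\<And>k. k < q \<Longrightarrow> t (Suc k) - t k + \<bar>a\<bar> < m"
    and probe: "\<And>v. v \<in> {0..<m} \<Longrightarrow> v + a \<in> {0..<m} \<Longrightarrow> L v = L (v + a) * cis w"
  shows "H (z + a) = H z * cis w"
proof -
  \<comment> \<open>The smaller of the two pixels is placed among the first
    \<open>m - \<bar>a\<bar>\<close> positions of a block, which leaves room for the larger
    one.\<close>
  define y where "y = min z (z + a) mod n"
  obtain k where k: "k < q" "t k \<le> y" "y < t k + (m - \<bar>a\<bar>)"
    using cover_by_steps[of t y q "m - \<bar>a\<bar>"] overlap \<open>0 < n\<close> \<open>t 0 = 0\<close> \<open>t q = n\<close>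
    by (force simp: y_def)
  \<comment> \<open>The local position of \<open>z\<close> in block \<open>k\<close>, up to a
    multiple of \<open>n\<close>; the last summand is \<open>0\<close> or
    \<open>\<bar>a\<bar>\<close> according to the sign of \<open>a\<close>.\<close>
  define v where "v = y - t k + (z - min z (z + a))"
  have v: "v \<in> {0..<m}" "v + a \<in> {0..<m}"
    using k by (auto simp: v_def min_def)
  have eq: "H (v + b + t k) = H (z + b)" for b
  proof -
    have "(v + b + t k) mod n = (z + b) mod n"
      unfolding v_def y_def
      by (metis (no_types, opaque_lifting) add.commute add_diff_cancel_left' diff_add_cancel
          diff_diff_eq2 mod_add_left_eq add.assoc)
    then show ?thesis using periodic_mod[of H n, OF period] by metis
  qed
  have "H (v + a + t k) * L (v + a) = H (v + t k) * L v"
    using block[OF k(1)] v by simp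
  also have "\<dots> = H (v + t k) * cis w * L (v + a)"
    using probe[OF v] by simp
  finally have "H (v + a + t k) = H (v + t k) * cis w"
    using block[OF k(1) v(2)] by (metis cis_neq_zero mult_cancel_right mult_zero_right)
  then show ?thesis using eq[of a] eq[of 0] by simp
qed

text \<open>Freezing \<open>y\<close> reduces the claim to one dimension. Keeping \<open>t\<close>
  and \<open>s\<close> separate lets the lemma serve both directions, with the coordinates
  exchanged.\<close>

lemma grid_unit_step:
  fixes h L :: "int \<Rightarrow> int \<Rightarrow> complex" and t s :: "nat \<Rightarrow> int" and \<Theta> :: "nat \<Rightarrow> nat \<Rightarrow> real"
  assumes block: "\<And>k l x y. x \<in> {0..<m} \<Longrightarrow> y \<in> {0..<m} \<Longrightarrow>
        h (x + t k) (y + s l) * L x y = cis (\<Theta> k l)"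
    and period: "\<And>x y. h (x + n) y = h x y" "\<And>x y. h x (y + n) = h x y"
    and "0 < n" "t 0 = 0" "t q = n" "s 0 = 0" "s q = n"
    and overlap_t: "\<And>j k. j \<in> J \<Longrightarrow> k < q \<Longrightarrow> t (Suc k) - t k + \<bar>a j\<bar> < m"
    and overlap_s: "\<And>k. k < q \<Longrightarrow> s (Suc k) - s k \<le> m"
    and a: "\<And>j. j \<in> J \<Longrightarrow> a j = 2 * t (j + 1) - t j - t (j + 2)"
    and dist: "\<And>j. j \<in> J \<Longrightarrow> \<bar>t (j + 2) - t j\<bar> \<le> m"
    and D: "\<And>j. j \<in> J \<Longrightarrow> \<exists>l. D j = 2 * \<Theta> (j + 1) l - \<Theta> (j + 2) l - \<Theta> j l"
    and "finite J" and bezout: "(\<Sum>j\<in>J. c j * a j) = 1"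
  shows "h (x + 1) y = h x y * cis (\<Sum>j\<in>J. of_int (c j) * D j)"
proof -
  obtain l where l: "l < q" "s l \<le> y mod n" "y mod n < s l + m"
    using cover_by_steps[of s "y mod n" q m] overlap_s \<open>0 < n\<close> \<open>s 0 = 0\<close> \<open>s q = n\<close> by force
  define y' where "y' = y mod n - s l"
  have y': "y' \<in> {0..<m}" "y' + s l = y mod n" using l by (auto simp: y'_def)
  have h_row: "h z (y' + s l) = h z y" for z
    using periodic_mod[of "h z" n y, OF period(2)] y'(2) by simp
  have step: "h (z + a j) y = h z y * cis (D j)" if "j \<in> J" for j z
  proof (rule object_ratio_shift[where H = "\<lambda>x. h x y" and L = "\<lambda>x. L x y'"])
    fix v assume v: "v \<in> {0..<m}" "v + a j \<in> {0..<m}"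
    \<comment> \<open>\<open>l'\<close> may differ from \<open>l\<close>: the law for
      \<open>L\<close> on the row \<open>y'\<close> does not mention \<open>h\<close>, so it can be
      read off in any block row.\<close>
    obtain l' where "D j = 2 * \<Theta> (j + 1) l' - \<Theta> (j + 2) l' - \<Theta> j l'"
      using D[OF \<open>j \<in> J\<close>] by blast
    then show "L v y' = L (v + a j) y' * cis (D j)"
      using probe_ratio_shift[where H = "\<lambda>x. h x (y' + s l')" and L = "\<lambda>x. L x y'",
          OF block block block dist[OF \<open>j \<in> J\<close>] a[OF \<open>j \<in> J\<close>] v] y'(1) by simp
  next
    show "h (x + t k) y * L x y' = cis (\<Theta> k l)" if "x \<in> {0..<m}" for k x
      using block[OF that y'(1), of k l] by (simp add: h_row)
  qed (use assms that in auto)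
  show ?thesis
    using translation_combination[OF \<open>finite J\<close>, of "\<lambda>x. h x y" a D x c] step bezout by simp
qed

theorem theorem5p5:
  fixes m n q \<tau> :: nat
    and \<delta> :: "nat \<Rightarrow> nat \<Rightarrow> int"
    and f g \<mu> \<nu> :: "pixel \<Rightarrow> complex"
    and \<alpha> \<phi> :: "pixel \<Rightarrow> real"
    and \<theta> :: "nat \<Rightarrow> nat \<Rightarrow> real"
    and c :: "nat \<Rightarrow> nat \<Rightarrow> int"
    and \<Delta>1 \<Delta>2 :: "nat \<Rightarrow> real"
    and r :: "real \<times> real"
    and J :: "nat set"
  assumes "0 < m" and "m < n" and "n = q * \<tau>"
    and "\<delta> 1 0 = 0" and "\<delta> 2 0 = 0"
    and f_nonzero: "\<forall>p\<in>torus n. f p \<noteq> 0"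
    and probe: "is_probe n m \<mu>" and probe_estimate: "is_probe n m \<nu>"
    and polar: "\<forall>p\<in>init_area m. \<alpha> p > 0 \<and>
          \<nu> p / \<mu> p = complex_of_real (\<alpha> p) * exp (\<i> * complex_of_real (\<phi> p))"
    and blocks: "\<forall>k<q. \<forall>l<q. \<forall>p\<in>shifted_area n m (scan_pos \<tau> \<delta> k l).
          shifted_probe n (scan_pos \<tau> \<delta> k l) \<nu> p * g p =
          exp (\<i> * complex_of_real (\<theta> k l)) * (shifted_probe n (scan_pos \<tau> \<delta> k l) \<mu> p * f p)"
    and J_eq: "J = good_indices m q \<tau> \<delta>"
    and backtracking: "bounded_backtracking m q \<tau> \<delta> J"
    and gcd_one: "\<forall>i\<in>{1,2}. (GCD j\<in>J. \<bar>second_diff q \<delta> i j\<bar>) = 1"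
    and c_support: "\<forall>i\<in>{1,2}. \<forall>j<q. c i j \<noteq> 0 \<longrightarrow> j \<in> J"
    and c_bezout: "\<forall>i\<in>{1,2}. (\<Sum>j<q. c i j * second_diff q \<delta> i j) = 1"
    and Delta1: "\<forall>k<q. \<exists>l<q. \<Delta>1 k = phase_diff1 q \<theta> k l"
    and Delta2: "\<forall>l<q. \<exists>k<q. \<Delta>2 l = phase_diff2 q \<theta> k l"
    and r_eq: "r = (\<Sum>k<q. real_of_int (c 1 k) * \<Delta>1 k, \<Sum>l<q. real_of_int (c 2 l) * \<Delta>2 l)"
  shows "(\<forall>k<q. \<forall>l<q. \<forall>l'<q. [phase_diff1 q \<theta> k l = phase_diff1 q \<theta> k l'] (rmod (2 * pi))) \<and>
    (\<forall>l<q. \<forall>k<q. \<forall>k'<q. [phase_diff2 q \<theta> k l = phase_diff2 q \<theta> k' l] (rmod (2 * pi))) \<and>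
    (\<forall>p\<in>torus n. g p / f p =
        exp (\<i> * complex_of_real (\<theta> 0 0 - \<phi> (0, 0))) *
        (inverse (complex_of_real (\<alpha> (0, 0))) * exp (\<i> * complex_of_real (dotp p r)))) \<and>
    (\<forall>p\<in>init_area m. \<nu> p / \<mu> p =
        complex_of_real (\<alpha> (0, 0)) *
        exp (\<i> * complex_of_real (\<phi> (0, 0)) - \<i> * complex_of_real (dotp p r))) \<and>
    (\<forall>k<q. \<forall>l<q. [\<theta> k l = \<theta> 0 0 + dotp (scan_pos \<tau> \<delta> k l) r] (rmod (2 * pi)))"
proof -

  \<comment> \<open>Periodic extension of the scan and the block relations\<close>
  \<comment> \<open>Only the perturbation is reduced modulo \<open>q\<close>; the linear part keeps
    growing, so that \<open>t q = n\<close> and differences across the period need no case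
    distinction.\<close>
  define t where "t k = int \<tau> * int k + \<delta> 1 (k mod q)" for k
  define s where "s k = int \<tau> * int k + \<delta> 2 (k mod q)" for k
  define \<Theta> where "\<Theta> k l = \<theta> (k mod q) (l mod q)" for k l
  define h where "h x y = g (wrap n (x, y)) / f (wrap n (x, y))" for x y
  define L where "L x y = \<nu> (x, y) / \<mu> (x, y)" for x y
  have "0 < n" "0 < q" using \<open>m < n\<close> \<open>n = q * \<tau>\<close> by (auto intro!: gr0I)
  have period: "h (x + int n) y = h x y" "h x (y + int n) = h x y" for x y
    by (simp_all add: h_def wrap_def)
  have ends: "t 0 = 0" "t q = int n" "s 0 = 0" "s q = int n"
    using \<open>0 < q\<close> assms(3-5) by (simp_all add: t_def s_def)
  have scan_wrap: "int \<tau> * int (k mod q) mod int n = int \<tau> * int k mod int n" for k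
    unfolding \<open>n = q * \<tau>\<close> of_nat_mult[symmetric] zmod_int[symmetric]
    by (simp add: mod_mult_mult2 mult.commute)
  have block: "h (x + t k) (y + s l) * L x y = cis (\<Theta> k l)"
    if x: "x \<in> {0..<int m}" and y: "y \<in> {0..<int m}" for k l x y
  proof -
    let ?k = "k mod q" and ?l = "l mod q"
    let ?T = "scan_pos \<tau> \<delta> ?k ?l"
    let ?p = "wrap n ((x, y) + ?T)"
    have kl: "?k < q" "?l < q" using \<open>0 < q\<close> by auto
    have area: "(x, y) \<in> init_area m" using x y by (simp add: init_area_def)
    then have "(x, y) \<in> torus n" using \<open>m < n\<close> by (auto simp: init_area_def torus_def)
    then have nz: "\<mu> (x, y) \<noteq> 0"
      using probe area by (auto simp: is_probe_def)
    have mod: "(x + (int \<tau> * int k + e)) mod int n = (x + (int \<tau> * int (k mod q) + e)) mod int n"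
      for x e k by (metis scan_wrap mod_add_left_eq mod_add_right_eq)
    have p: "?p = wrap n (x + t k, y + s l)"
      by (simp add: wrap_def scan_pos_def t_def s_def flip: mod)
    have "?p \<in> torus n" using \<open>0 < n\<close> by (simp add: torus_def wrap_def)
    then have "f ?p \<noteq> 0" using f_nonzero by blast
    have "wrap n (?p - ?T) = (x, y)"
      using x y \<open>m < n\<close> by (simp add: wrap_def scan_pos_def mod_diff_left_eq)
    then have "\<nu> (x, y) * g ?p = exp (\<i> * \<theta> ?k ?l) * (\<mu> (x, y) * f ?p)"
      using blocks[rule_format, OF kl, of ?p] area
      by (auto simp: shifted_area_def shifted_probe_def)
    then show ?thesis
      using nz \<open>f ?p \<noteq> 0\<close> by (simp add: h_def L_def \<Theta>_def cis_conv_exp p field_simps)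
  qed
  have J: "J \<subseteq> {..<q}" "finite J"
    by (auto simp: J_eq good_indices_def intro: finite_subset[of _ "{..<q}"])
  \<comment> \<open>Polymorphic, since it serves the integer Bezout sum and the real sums in
    \<open>r\<close>.\<close>
  have reduce: "(\<Sum>j<q. of_int (c i j) * u j) = (\<Sum>j\<in>J. of_int (c i j) * u j)"
    if "i \<in> {1, 2}" for i and u :: "nat \<Rightarrow> 'a :: comm_ring_1"
    using c_support that J by (intro sum.mono_neutral_right) auto
  have scan_Suc: "int \<tau> * int (Suc k) = int \<tau> * int k + int \<tau>" for k
    by (simp add: algebra_simps)
  have overlap: "int \<tau> + \<delta> i (Suc k mod q) - \<delta> i k + \<bar>second_diff q \<delta> i j\<bar> < int m"
    if "j \<in> J" "k < q" "i \<in> {1, 2}" for i j k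
  proof -
    let ?F = "\<lambda>k i. \<bar>second_diff q \<delta> i j\<bar> + \<delta> i ((k + 1) mod q) - \<delta> i k"
    have "?F k i \<le> (MAX i\<in>{1,2}. ?F k i)"
      using that by (intro Max_ge) auto
    also have "\<dots> \<le> (MAX k\<in>{..<q}. MAX i\<in>{1,2}. ?F k i)"
      using that by (intro Max_ge) auto
    finally show ?thesis using \<open>j \<in> J\<close> by (simp add: J_eq good_indices_def)
  qed
  \<comment> \<open>The upper bound comes from the second condition on good indices, the lower one
    from \<open>backtracking\<close>.\<close>
  have dist: "\<bar>2 * int \<tau> + \<delta> i ((j + 2) mod q) - \<delta> i j\<bar> \<le> int m"
    if "j \<in> J" "i \<in> {1, 2}" for i j
  proof -
    have "\<delta> i ((j + 2) mod q) - \<delta> i j \<le> (MAX i\<in>{1,2}. \<delta> i ((j + 2) mod q) - \<delta> i j)"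
      using that by (intro Max_ge) auto
    then show ?thesis
      using that backtracking by (auto simp: J_eq good_indices_def bounded_backtracking_def)
  qed
  \<comment> \<open>An empty gcd would be 0. Any member \<open>j0\<close> yields the overlap bound
    for the direction that is held fixed below.\<close>
  have "J \<noteq> {}" using gcd_one by force
  then obtain j0 where "j0 \<in> J" by blast

  \<comment> \<open>Unit translations of the object ratio\<close>
  have step1: "h (x + 1) y = h x y * cis (fst r)" for x y
  proof -
    have "h (x + 1) y = h x y * cis (\<Sum>j\<in>J. of_int (c 1 j) * \<Delta>1 j)"
    proof (rule grid_unit_step[where t = t and s = s and L = L and a = "second_diff q \<delta> 1",
          OF block period])
      show "\<exists>l. \<Delta>1 j = 2 * \<Theta> (j + 1) l - \<Theta> (j + 2) l - \<Theta> j l" if "j \<in> J" for j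
      proof -
        have "j < q" using that J by blast
        with Delta1 obtain l where "l < q" "\<Delta>1 j = phase_diff1 q \<theta> j l" by blast
        with \<open>j < q\<close> show ?thesis by (intro exI[of _ l]) (simp add: \<Theta>_def phase_diff1_def)
      qed
    next
      show "s (Suc k) - s k \<le> int m" if "k < q" for k
        using overlap[OF \<open>j0 \<in> J\<close> that, of 2] that unfolding s_def scan_Suc by simp
    next
      show "(\<Sum>j\<in>J. c 1 j * second_diff q \<delta> 1 j) = 1"
        using reduce[of 1 "second_diff q \<delta> 1"] c_bezout by simp
    next
      show "t (Suc k) - t k + \<bar>second_diff q \<delta> 1 j\<bar> < int m" if "j \<in> J" "k < q" for j k
        using overlap[OF that, of 1] that unfolding t_def scan_Suc by simp
    next
      show "\<bar>t (j + 2) - t j\<bar> \<le> int m" if "j \<in> J" for j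
        using dist[OF that, of 1] that J by (auto simp: t_def algebra_simps subset_iff)
    next
      show "second_diff q \<delta> 1 j = 2 * t (j + 1) - t j - t (j + 2)" if "j \<in> J" for j
        using that J by (auto simp: t_def second_diff_def algebra_simps subset_iff)
    qed (use \<open>0 < n\<close> ends J in auto)
    then show ?thesis by (simp add: r_eq reduce)
  qed
  have step2: "h x (y + 1) = h x y * cis (snd r)" for x y
  proof -
    have "h x (y + 1) = h x y * cis (\<Sum>j\<in>J. of_int (c 2 j) * \<Delta>2 j)"
    proof (rule grid_unit_step[where h = "\<lambda>y x. h x y" and t = s and s = t and
          L = "\<lambda>y x. L x y" and \<Theta> = "\<lambda>l k. \<Theta> k l" and a = "second_diff q \<delta> 2",
          OF block period(2,1)])
      show "\<exists>l. \<Delta>2 j = 2 * \<Theta> l (j + 1) - \<Theta> l (j + 2) - \<Theta> l j" if "j \<in> J" for j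
      proof -
        have "j < q" using that J by blast
        with Delta2 obtain l where "l < q" "\<Delta>2 j = phase_diff2 q \<theta> l j" by blast
        with \<open>j < q\<close> show ?thesis by (intro exI[of _ l]) (simp add: \<Theta>_def phase_diff2_def)
      qed
    next
      show "t (Suc k) - t k \<le> int m" if "k < q" for k
        using overlap[OF \<open>j0 \<in> J\<close> that, of 1] that unfolding t_def scan_Suc by simp
    next
      show "(\<Sum>j\<in>J. c 2 j * second_diff q \<delta> 2 j) = 1"
        using reduce[of 2 "second_diff q \<delta> 2"] c_bezout by simp
    next
      show "s (Suc k) - s k + \<bar>second_diff q \<delta> 2 j\<bar> < int m" if "j \<in> J" "k < q" for j k
        using overlap[OF that, of 2] that unfolding s_def scan_Suc by simp
    next
      show "\<bar>s (j + 2) - s j\<bar> \<le> int m" if "j \<in> J" for j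
        using dist[OF that, of 2] that J by (auto simp: s_def algebra_simps subset_iff)
    next
      show "second_diff q \<delta> 2 j = 2 * s (j + 1) - s j - s (j + 2)" if "j \<in> J" for j
        using that J by (auto simp: s_def second_diff_def algebra_simps subset_iff)
    qed (use \<open>0 < n\<close> ends J in auto)
    then show ?thesis by (simp add: r_eq reduce)
  qed

  \<comment> \<open>Affine profiles of object, probe and block phases\<close>
  have h_affine: "h x y = h 0 0 * cis (dotp (x, y) r)" for x y
    using translation_multiple[of "\<lambda>x. h x y" 1 "fst r" 0 x, OF step1]
      translation_multiple[of "h 0" 1 "snd r" 0 y, OF step2]
    by (simp add: dotp_def cis_mult mult.assoc add.commute)
  have origin: "(0, 0) \<in> init_area m" using \<open>0 < m\<close> by (simp add: init_area_def)
  define z where "z = cis (\<phi> (0, 0))"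
  have L0: "L 0 0 = of_real (\<alpha> (0, 0)) * z" and "\<alpha> (0, 0) > 0"
    using polar origin by (simp_all add: L_def z_def cis_conv_exp)
  have h0: "h 0 0 * L 0 0 = cis (\<theta> 0 0)"
    using block[of 0 0 0 0] \<open>0 < m\<close> ends \<open>0 < q\<close> by (simp add: \<Theta>_def)
  have "h 0 0 \<noteq> 0" "L 0 0 \<noteq> 0" using h0 by auto
  \<comment> \<open>Block \<open>(0, 0)\<close> at its corner pixel fixes the remaining constant;
    this is the source of the global phase factor
    \<open>\<theta> 0 0 - \<phi> (0, 0)\<close>.\<close>
  have h0': "h 0 0 = cis (\<theta> 0 0 - \<phi> (0, 0)) * inverse (of_real (\<alpha> (0, 0)))"
    using h0 \<open>\<alpha> (0, 0) > 0\<close> unfolding L0 z_def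
    by (simp add: cis_divide[symmetric] field_simps)
  have object: "g p / f p = exp (\<i> * of_real (\<theta> 0 0 - \<phi> (0, 0))) *
      (inverse (of_real (\<alpha> (0, 0))) * exp (\<i> * of_real (dotp p r)))" if "p \<in> torus n" for p
  proof -
    obtain x y where p: "p = (x, y)" by fastforce
    have "wrap n p = p" using that by (auto simp: torus_def wrap_def)
    then show ?thesis using h_affine[of x y] unfolding h0' by (simp add: p h_def cis_conv_exp)
  qed
  \<comment> \<open>Block \<open>(0, 0)\<close> is unshifted, so there the probe ratio is a constant
    divided by the affine object ratio.\<close>
  have probe_affine: "\<nu> p / \<mu> p = of_real (\<alpha> (0, 0)) *
      exp (\<i> * of_real (\<phi> (0, 0)) - \<i> * of_real (dotp p r))" if "p \<in> init_area m" for p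
  proof -
    obtain x y where p: "p = (x, y)" by fastforce
    have "h x y * L x y = cis (\<theta> 0 0)"
      using block[of x y 0 0] that ends by (simp add: p init_area_def \<Theta>_def)
    then have "h 0 0 * (cis (dotp p r) * L x y) = h 0 0 * L 0 0"
      using h_affine[of x y] h0 by (simp add: p mult.assoc)
    then have "cis (dotp p r) * L x y = L 0 0"
      using \<open>h 0 0 \<noteq> 0\<close> by simp
    then have "L x y = L 0 0 / cis (dotp p r)"
      by (simp add: field_simps)
    also have "\<dots> = of_real (\<alpha> (0, 0)) * cis (\<phi> (0, 0) - dotp p r)"
      by (simp add: L0 z_def cis_divide[symmetric])
    finally show ?thesis by (simp add: p L_def cis_conv_exp right_diff_distrib)
  qed
  \<comment> \<open>At the local pixel \<open>(0, 0)\<close> the object position is the scan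
    position itself.\<close>
  have phases_ext: "[\<Theta> k l = \<theta> 0 0 + dotp (t k, s l) r] (rmod (2 * pi))" for k l
  proof -
    have "cis (\<Theta> k l) = h 0 0 * L 0 0 * cis (dotp (t k, s l) r)"
      using block[of 0 0 k l] h_affine[of "t k" "s l"] \<open>0 < m\<close> by (simp add: mult_ac)
    then show ?thesis
      by (simp add: h0 cis_mult flip: cis_eq_iff)
  qed
  have phases: "[\<theta> k l = \<theta> 0 0 + dotp (scan_pos \<tau> \<delta> k l) r] (rmod (2 * pi))"
    if "k < q" "l < q" for k l
    using phases_ext[of k l] that by (simp add: \<Theta>_def scan_pos_def t_def s_def)
  \<comment> \<open>Congruence modulo \<open>2 * pi\<close> respects sums but not real multiples, so
    \<open>2 * u\<close> is handled as \<open>u + u\<close>.\<close>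
  have double_diff: "[2 * u' - v' - w' = 2 * u - v - w] (rmod (2 * pi))"
    if "[u' = u] (rmod (2 * pi))" "[v' = v] (rmod (2 * pi))" "[w' = w] (rmod (2 * pi))"
    for u u' v v' w w' :: real
    using rcong_diff[OF rcong_diff[OF rcong_add[OF that(1,1)] that(2)] that(3)] by simp
  \<comment> \<open>The \<open>s l\<close> terms cancel, so the right-hand side is free of
    \<open>l\<close>; transitivity then gives independence of the second index.\<close>
  have diff1: "[phase_diff1 q \<theta> k l = (2 * t (k + 1) - t (k + 2) - t k) * fst r]
      (rmod (2 * pi))"
    if "k < q" "l < q" for k l
    using double_diff[OF phases_ext[of "k + 1" l] phases_ext[of "k + 2" l] phases_ext[of k l]] that
    by (simp add: phase_diff1_def \<Theta>_def dotp_def algebra_simps)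
  have diff2: "[phase_diff2 q \<theta> k l = (2 * s (l + 1) - s (l + 2) - s l) * snd r]
      (rmod (2 * pi))"
    if "k < q" "l < q" for k l
    using double_diff[OF phases_ext[of k "l + 1"] phases_ext[of k "l + 2"] phases_ext[of k l]] that
    by (simp add: phase_diff2_def \<Theta>_def dotp_def algebra_simps)
  show ?thesis
    using rcong_trans[OF diff1 rcong_sym[OF diff1]] rcong_trans[OF diff2 rcong_sym[OF diff2]]
      object probe_affine phases by blast
qed

end
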